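(* Let $\ell\ge1$, $m\ge0$, positive integers $n_0,\dots,n_m$ with $n:=\sum_j n_j-1$, distinct points $z_0=0,z_1,\dots,z_m$ in the open unit disc, and $\ell\times\ell$ matrices $W_{jk}$ be given, with $W$, $Z$, $e$, $S$ as below. Suppose $W$ satisfies the generalized Pick condition $W(S\otimes I_\ell)+(S\otimes I_\ell)W^*>0$. Let $T=(W-\tfrac12I)(W+\tfrac12I)^{-1}$ and, for $\lambda\in[0,1]$, $W(\lambda)=(I-\lambda T)^{-1}-\tfrac12 I$. Then for all $\lambda\in[0,1]$, $$W(\lambda)(S\otimes I_\ell)+(S\otimes I_\ell)W(\lambda)^*>0.$$
   Context: $W_j$ is the $\ell n_j\times\ell n_j$ block lower-triangular block-Toeplitz matrix with $W_{j0}$ on the block diagonal and $W_{jk}$ on the $k$-th block subdiagonal ($k=1,\dots,n_j-1$); $W=\operatorname{diag}(W_0,\dots,W_m)$. $Z_j$ is the $n_j\times n_j$ lower bidiagonal matrix with $z_j$ on the diagonal and $1$ on the subdiagonal; $Z=\operatorname{diag}(Z_0,\dots,Z_m)$. $e\in\mathbb{R}^{n+1}$ stacks the vectors $(1,0,\dots,0)'\in\mathbb{R}^{n_j}$, $j=0,\dots,m$. $S$ is the unique solution of the Lyapunov equation $S=ZSZ^*+ee'$. $\otimes$ is the Kronecker product, $^*$ conjugate transpose, and $>0$ means positive definite. *)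

theory Defs
  imports "Jordan_Normal_Form.Schur_Decomposition"
begin

text \<open>Positive definiteness of a complex square matrix: Hermitian and
  Re (x^* A x) > 0 for every nonzero vector x.\<close>
definition pos_def_mat :: "complex mat \<Rightarrow> bool" where
  "pos_def_mat A \<longleftrightarrow> square_mat A \<and> mat_adjoint A = A \<and>
     (\<forall>v \<in> carrier_vec (dim_row A). v \<noteq> 0\<^sub>v (dim_row A) \<longrightarrow>
        Re (conjugate v \<bullet> (A *\<^sub>v v)) > 0)"

text \<open>Inverse of an invertible square matrix.\<close>
definition minv :: "complex mat \<Rightarrow> complex mat" where
  "minv A = (SOME B. B \<in> carrier_mat (dim_row A) (dim_row A) \<and>
                      A * B = 1\<^sub>m (dim_row A) \<and> B * A = 1\<^sub>m (dim_row A))"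

text \<open>Kronecker product A \<otimes> I_l (index (i1,i2) \<mapsto> i1*l + i2).\<close>
definition kron_id :: "complex mat \<Rightarrow> nat \<Rightarrow> complex mat" where
  "kron_id A l = mat (dim_row A * l) (dim_col A * l)
     (\<lambda>(r,c). if r mod l = c mod l then A $$ (r div l, c div l) else 0)"

text \<open>W_j: l n_j x l n_j block lower-triangular block-Toeplitz matrix with
  block Wb j k on the k-th block subdiagonal.\<close>
definition toeplitz_block :: "nat \<Rightarrow> nat \<Rightarrow> (nat \<Rightarrow> complex mat) \<Rightarrow> complex mat" where
  "toeplitz_block l nj Wj = mat (l * nj) (l * nj)
     (\<lambda>(r,c). if c div l \<le> r div l then Wj (r div l - c div l) $$ (r mod l, c mod l) else 0)"

definition W_big :: "nat \<Rightarrow> nat \<Rightarrow> (nat \<Rightarrow> nat) \<Rightarrow> (nat \<Rightarrow> nat \<Rightarrow> complex mat) \<Rightarrow> complex mat" where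
  "W_big l m ns Wb = diag_block_mat (map (\<lambda>j. toeplitz_block l (ns j) (Wb j)) [0..<Suc m])"

text \<open>Z_j: n_j x n_j lower bidiagonal with z_j on the diagonal, 1 on the subdiagonal.\<close>
definition Z_block :: "nat \<Rightarrow> complex \<Rightarrow> complex mat" where
  "Z_block nj zj = mat nj nj (\<lambda>(i,k). if i = k then zj else if i = Suc k then 1 else 0)"

definition Z_big :: "nat \<Rightarrow> (nat \<Rightarrow> nat) \<Rightarrow> (nat \<Rightarrow> complex) \<Rightarrow> complex mat" where
  "Z_big m ns z = diag_block_mat (map (\<lambda>j. Z_block (ns j) (z j)) [0..<Suc m])"

text \<open>Total size n + 1 = sum of the n_j, and the stacked vector e.\<close>
definition total_size :: "nat \<Rightarrow> (nat \<Rightarrow> nat) \<Rightarrow> nat" where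
  "total_size m ns = (\<Sum>j\<le>m. ns j)"

definition e_vec :: "nat \<Rightarrow> (nat \<Rightarrow> nat) \<Rightarrow> complex vec" where
  "e_vec m ns = vec (total_size m ns)
     (\<lambda>r. if \<exists>j\<le>m. r = (\<Sum>i<j. ns i) then 1 else 0)"

text \<open>The rank-one matrix e e'.\<close>
definition outer_e :: "nat \<Rightarrow> (nat \<Rightarrow> nat) \<Rightarrow> complex mat" where
  "outer_e m ns = mat (total_size m ns) (total_size m ns)
     (\<lambda>(i,k). e_vec m ns $ i * e_vec m ns $ k)"

end

theory Submission
  imports Defs
begin

(* Write K = S (x) I_l and P(X) = X K + K X^* for the Pick matrix of X.
   The adjoint of Z is upper triangular with its diagonal z_j in the unit disc, so iterating
   the Stein equation gives x^* S y = sum_k (Z^*^k x)^* e e' (Z^*^k y): S, and hence K, is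
   positive semidefinite.
   For A = W + I/2, a vector y with A^* y = 0 would give y^* P(W) y = - y^* K y <= 0, so A is
   invertible and B = A^-1 = I - T. Whenever Y X = I, Y (P(X) - K) Y^* = P(Y) - Y K Y^*; with
   X = A and Y = B this turns P(W) > 0 into K - T K T^* > 0.
   For M = I - lambda T one computes P(M) - M K M^* = K - lambda^2 T K T^*, which dominates
   K - T K T^* > 0. The left-hand side vanishes at every y with M^* y = 0, so M is invertible,
   and the identity with X = M^-1, Y = M shows M P(W(lambda)) M^* = K - lambda^2 T K T^* > 0,
   i.e. P(W(lambda)) > 0. *)

section \<open>Adjoints and sesquilinear forms\<close>

lemma dim_mat_adjoint[simp]:
  "dim_row (mat_adjoint (A :: complex mat)) = dim_col A"
  "dim_col (mat_adjoint (A :: complex mat)) = dim_row A"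
  unfolding mat_adjoint_def by auto

lemma index_mat_adjoint[simp]:
  "i < dim_col A \<Longrightarrow> j < dim_row A \<Longrightarrow> mat_adjoint (A :: complex mat) $$ (i, j) = cnj (A $$ (j, i))"
  unfolding mat_adjoint_def by (subst mat_of_rows_index) auto

lemma mat_adjoint_carrier_mat[simp]:
  "(A :: complex mat) \<in> carrier_mat n m \<Longrightarrow> mat_adjoint A \<in> carrier_mat m n"
  by (intro carrier_matI) auto

lemma mat_adjoint_mat_adjoint[simp]: "mat_adjoint (mat_adjoint (A :: complex mat)) = A"
  by (rule eq_matI) auto

lemma mat_adjoint_one[simp]: "mat_adjoint (1\<^sub>m n :: complex mat) = 1\<^sub>m n"
  by (rule eq_matI) auto

lemma mat_adjoint_mult:
  assumes "(A :: complex mat) \<in> carrier_mat n k" "B \<in> carrier_mat k m"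
  shows "mat_adjoint (A * B) = mat_adjoint B * mat_adjoint A"
  using assms by (intro eq_matI) (auto simp: scalar_prod_def cnj_sum mult.commute intro!: sum.cong)

lemma mat_adjoint_add:
  assumes "(A :: complex mat) \<in> carrier_mat n m" "B \<in> carrier_mat n m"
  shows "mat_adjoint (A + B) = mat_adjoint A + mat_adjoint B"
  using assms by (intro eq_matI) auto

lemma mat_adjoint_minus:
  assumes "(A :: complex mat) \<in> carrier_mat n m" "B \<in> carrier_mat n m"
  shows "mat_adjoint (A - B) = mat_adjoint A - mat_adjoint B"
  using assms by (intro eq_matI) auto

lemma mat_adjoint_smult: "mat_adjoint (c \<cdot>\<^sub>m (A :: complex mat)) = cnj c \<cdot>\<^sub>m mat_adjoint A"
  by (intro eq_matI) auto

lemma mult_carrier_mat_square[simp]: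
  "A \<in> carrier_mat n n \<Longrightarrow> B \<in> carrier_mat n n \<Longrightarrow> A * B \<in> carrier_mat n n"
  by (rule mult_carrier_mat)

lemma mult_mat_vec_carrier_square[simp]:
  "A \<in> carrier_mat n n \<Longrightarrow> v \<in> carrier_vec n \<Longrightarrow> A *\<^sub>v v \<in> carrier_vec n"
  by (rule mult_mat_vec_carrier)

declare minus_carrier_mat[simp]

lemma sesq_sum:
  assumes "(A :: complex mat) \<in> carrier_mat n m" "x \<in> carrier_vec n" "y \<in> carrier_vec m"
  shows "conjugate x \<bullet> (A *\<^sub>v y) = (\<Sum>i<n. \<Sum>j<m. cnj (x $ i) * A $$ (i, j) * y $ j)"
  using assms
  by (auto simp: scalar_prod_def sum_distrib_left mult.assoc lessThan_atLeast0 intro!: sum.cong)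

lemma sesq_adjoint:
  assumes A: "(A :: complex mat) \<in> carrier_mat n m" and x: "x \<in> carrier_vec n" and y: "y \<in> carrier_vec m"
  shows "conjugate x \<bullet> (A *\<^sub>v y) = conjugate (mat_adjoint A *\<^sub>v x) \<bullet> y"
proof -
  have "conjugate (mat_adjoint A *\<^sub>v x) \<bullet> y = (\<Sum>j<m. cnj (\<Sum>i<n. cnj (A $$ (i, j)) * x $ i) * y $ j)"
    using assms by (auto simp: scalar_prod_def lessThan_atLeast0 intro!: sum.cong)
  also have "\<dots> = (\<Sum>j<m. \<Sum>i<n. cnj (x $ i) * A $$ (i, j) * y $ j)"
    by (auto simp: cnj_sum sum_distrib_left sum_distrib_right mult.commute mult.left_commute
        intro!: sum.cong)
  also have "\<dots> = (\<Sum>i<n. \<Sum>j<m. cnj (x $ i) * A $$ (i, j) * y $ j)"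
    by (rule sum.swap)
  finally show ?thesis using sesq_sum[OF assms] by simp
qed

lemma sesq_mult:
  assumes A: "(A :: complex mat) \<in> carrier_mat n k" and B: "B \<in> carrier_mat k m"
    and x: "x \<in> carrier_vec n" and y: "y \<in> carrier_vec m"
  shows "conjugate x \<bullet> ((A * B) *\<^sub>v y) = conjugate (mat_adjoint A *\<^sub>v x) \<bullet> (B *\<^sub>v y)"
  using sesq_adjoint[OF A x, of "B *\<^sub>v y"] assoc_mult_mat_vec[OF A B y] B y by simp

lemma sesq_congruence:
  assumes C: "(C :: complex mat) \<in> carrier_mat n m" and P: "P \<in> carrier_mat m m"
    and x: "x \<in> carrier_vec n" and y: "y \<in> carrier_vec n"
  shows "conjugate x \<bullet> ((C * P * mat_adjoint C) *\<^sub>v y)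
    = conjugate (mat_adjoint C *\<^sub>v x) \<bullet> (P *\<^sub>v (mat_adjoint C *\<^sub>v y))"
proof -
  have Cy: "mat_adjoint C *\<^sub>v y \<in> carrier_vec m"
    using mult_mat_vec_carrier[OF mat_adjoint_carrier_mat[OF C] y] .
  have "(C * P * mat_adjoint C) *\<^sub>v y = C *\<^sub>v (P *\<^sub>v (mat_adjoint C *\<^sub>v y))"
    using assoc_mult_mat_vec[of "C * P" n m "mat_adjoint C" n y]
      assoc_mult_mat_vec[OF C P Cy] C P y by simp
  then show ?thesis using sesq_adjoint[OF C x mult_mat_vec_carrier[OF P Cy]] by simp
qed

lemma sesq_add:
  assumes "(A :: complex mat) \<in> carrier_mat n m" "B \<in> carrier_mat n m"
    "x \<in> carrier_vec n" "y \<in> carrier_vec m"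
  shows "conjugate x \<bullet> ((A + B) *\<^sub>v y) = conjugate x \<bullet> (A *\<^sub>v y) + conjugate x \<bullet> (B *\<^sub>v y)"
  using assms
  by (simp add: add_mult_distrib_mat_vec[where nr=n and nc=m] scalar_prod_add_distrib[where n=n])

lemma sesq_minus:
  assumes "(A :: complex mat) \<in> carrier_mat n m" "B \<in> carrier_mat n m"
    "x \<in> carrier_vec n" "y \<in> carrier_vec m"
  shows "conjugate x \<bullet> ((A - B) *\<^sub>v y) = conjugate x \<bullet> (A *\<^sub>v y) - conjugate x \<bullet> (B *\<^sub>v y)"
  using assms
  by (simp add: minus_mult_distrib_mat_vec[where nr=n and nc=m] scalar_prod_minus_distrib[where n=n])

lemma sesq_smult:
  assumes "(A :: complex mat) \<in> carrier_mat n m" "x \<in> carrier_vec n" "y \<in> carrier_vec m"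
  shows "conjugate x \<bullet> ((c \<cdot>\<^sub>m A) *\<^sub>v y) = c * (conjugate x \<bullet> (A *\<^sub>v y))"
  using assms by (simp add: sesq_sum[where n=n and m=m] sum_distrib_left mult_ac)

lemma sesq_hermitian:
  assumes A: "(A :: complex mat) \<in> carrier_mat n n" and herm: "mat_adjoint A = A"
    and x: "x \<in> carrier_vec n" and y: "y \<in> carrier_vec n"
  shows "conjugate x \<bullet> (A *\<^sub>v y) = cnj (conjugate y \<bullet> (A *\<^sub>v x))"
proof -
  have "conjugate y \<bullet> (A *\<^sub>v x) = conjugate (A *\<^sub>v y) \<bullet> x"
    using sesq_adjoint[OF A y x] herm by simp
  then show ?thesis using A x y by (simp add: scalar_prod_def cnj_sum mult.commute)
qed

lemma sesq_unit_vec: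
  assumes A: "(A :: complex mat) \<in> carrier_mat n n" and i: "i < n" and j: "j < n"
  shows "conjugate (unit_vec n i) \<bullet> (A *\<^sub>v unit_vec n j) = A $$ (i, j)"
proof -
  have "conjugate (unit_vec n i) \<bullet> (A *\<^sub>v unit_vec n j)
      = (\<Sum>a<n. \<Sum>b<n. (if a = i then 1 else 0) * A $$ (a, b) * (if b = j then 1 else 0))"
    unfolding sesq_sum[OF A unit_vec_carrier unit_vec_carrier] using i j by (intro sum.cong refl) auto
  also have "\<dots> = (\<Sum>a<n. if a = i then A $$ (a, j) else 0)"
    using j by (intro sum.cong refl) (auto simp: if_distrib cong: if_cong)
  also have "\<dots> = A $$ (i, j)" using i by simp
  finally show ?thesis .
qed

lemma sesq_tendsto_zero:
  assumes A: "(A :: complex mat) \<in> carrier_mat n n"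
    and v: "\<And>k. v k \<in> carrier_vec n" and w: "\<And>k. w k \<in> carrier_vec n"
    and v0: "\<And>i. i < n \<Longrightarrow> (\<lambda>k. v k $ i) \<longlonglongrightarrow> 0"
    and w0: "\<And>i. i < n \<Longrightarrow> (\<lambda>k. w k $ i) \<longlonglongrightarrow> 0"
  shows "(\<lambda>k. conjugate (v k) \<bullet> (A *\<^sub>v w k)) \<longlonglongrightarrow> 0"
  unfolding sesq_sum[OF A v w]
proof (intro tendsto_null_sum)
  fix i j assume "i \<in> {..<n}" "j \<in> {..<n}"
  then have "(\<lambda>k. cnj (v k $ i) * A $$ (i, j)) \<longlonglongrightarrow> 0"
    using tendsto_cnj[OF v0[of i]] by (simp add: tendsto_mult_left_zero)
  then show "(\<lambda>k. cnj (v k $ i) * A $$ (i, j) * w k $ j) \<longlonglongrightarrow> 0"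
    using w0[of j] \<open>j \<in> {..<n}\<close> tendsto_mult_zero by blast
qed

section \<open>Positive definite matrices\<close>

definition pos_semidef_mat :: "complex mat \<Rightarrow> bool" where
  "pos_semidef_mat A \<longleftrightarrow> square_mat A \<and> mat_adjoint A = A \<and>
     (\<forall>v \<in> carrier_vec (dim_row A). Re (conjugate v \<bullet> (A *\<^sub>v v)) \<ge> 0)"

lemma pos_semidef_matI:
  assumes "A \<in> carrier_mat n n" "mat_adjoint A = A"
    "\<And>v. v \<in> carrier_vec n \<Longrightarrow> Re (conjugate v \<bullet> (A *\<^sub>v v)) \<ge> 0"
  shows "pos_semidef_mat A"
  using assms unfolding pos_semidef_mat_def by auto

lemma pos_semidef_matD:
  assumes "pos_semidef_mat A" "A \<in> carrier_mat n n"
  shows "mat_adjoint A = A" "\<And>v. v \<in> carrier_vec n \<Longrightarrow> Re (conjugate v \<bullet> (A *\<^sub>v v)) \<ge> 0"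
  using assms unfolding pos_semidef_mat_def by auto

lemma pos_def_matI:
  assumes "A \<in> carrier_mat n n" "mat_adjoint A = A"
    "\<And>v. v \<in> carrier_vec n \<Longrightarrow> v \<noteq> 0\<^sub>v n \<Longrightarrow> Re (conjugate v \<bullet> (A *\<^sub>v v)) > 0"
  shows "pos_def_mat A"
  using assms unfolding pos_def_mat_def by auto

lemma pos_def_matD:
  assumes "pos_def_mat A" "A \<in> carrier_mat n n"
  shows "mat_adjoint A = A"
    "\<And>v. v \<in> carrier_vec n \<Longrightarrow> v \<noteq> 0\<^sub>v n \<Longrightarrow> Re (conjugate v \<bullet> (A *\<^sub>v v)) > 0"
  using assms unfolding pos_def_mat_def by auto

lemma mat_adjoint_congruence:
  assumes C: "(C :: complex mat) \<in> carrier_mat n m" and P: "P \<in> carrier_mat m m"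
    and herm: "mat_adjoint P = P"
  shows "mat_adjoint (C * P * mat_adjoint C) = C * P * mat_adjoint C"
proof -
  have "mat_adjoint (C * P * mat_adjoint C) = mat_adjoint (mat_adjoint C) * mat_adjoint (C * P)"
    using C P by (intro mat_adjoint_mult) auto
  also have "\<dots> = C * (P * mat_adjoint C)" using mat_adjoint_mult[OF C P] herm by simp
  also have "\<dots> = C * P * mat_adjoint C" using C P by (simp add: assoc_mult_mat[of C n m P m _ n])
  finally show ?thesis .
qed

lemma pos_semidef_mat_congruence:
  assumes K: "pos_semidef_mat K" "K \<in> carrier_mat n n" and C: "C \<in> carrier_mat n n"
  shows "pos_semidef_mat (C * K * mat_adjoint C)"
proof (rule pos_semidef_matI)
  show "C * K * mat_adjoint C \<in> carrier_mat n n" using C K by simp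
  show "mat_adjoint (C * K * mat_adjoint C) = C * K * mat_adjoint C"
    using mat_adjoint_congruence[OF C K(2) pos_semidef_matD(1)[OF K]] .
  show "Re (conjugate v \<bullet> ((C * K * mat_adjoint C) *\<^sub>v v)) \<ge> 0" if "v \<in> carrier_vec n" for v
    unfolding sesq_congruence[OF C K(2) that that] using pos_semidef_matD(2)[OF K] C that by simp
qed

lemma pos_def_mat_congruence:
  assumes P: "pos_def_mat P" "P \<in> carrier_mat n n"
    and C: "C \<in> carrier_mat n n" and D: "D \<in> carrier_mat n n" and CD: "C * D = 1\<^sub>m n"
  shows "pos_def_mat (C * P * mat_adjoint C)"
proof (rule pos_def_matI)
  show "C * P * mat_adjoint C \<in> carrier_mat n n" using C P by simp
  show "mat_adjoint (C * P * mat_adjoint C) = C * P * mat_adjoint C"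
    using mat_adjoint_congruence[OF C P(2) pos_def_matD(1)[OF P]] .
  fix v :: "complex vec" assume v: "v \<in> carrier_vec n" "v \<noteq> 0\<^sub>v n"
  have "mat_adjoint D * mat_adjoint C = 1\<^sub>m n" using mat_adjoint_mult[OF C D] CD by simp
  then have "mat_adjoint D *\<^sub>v (mat_adjoint C *\<^sub>v v) = v"
    using C D v by (simp flip: assoc_mult_mat_vec[of _ n n _ n])
  moreover have "mat_adjoint D *\<^sub>v 0\<^sub>v n = 0\<^sub>v n"
    using D by (intro eq_vecI) (auto simp: scalar_prod_def)
  ultimately have "mat_adjoint C *\<^sub>v v \<noteq> 0\<^sub>v n" using v(2) by metis
  then show "Re (conjugate v \<bullet> ((C * P * mat_adjoint C) *\<^sub>v v)) > 0"
    unfolding sesq_congruence[OF C P(2) v(1) v(1)] using pos_def_matD(2)[OF P] C v by simp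
qed

lemma pos_def_mat_minus_smult:
  assumes K: "pos_semidef_mat K" "K \<in> carrier_mat n n"
    and X: "pos_semidef_mat X" "X \<in> carrier_mat n n"
    and KX: "pos_def_mat (K - X)" and s: "0 \<le> s" "s \<le> 1"
  shows "pos_def_mat (K - complex_of_real s \<cdot>\<^sub>m X)"
proof (rule pos_def_matI)
  show "K - complex_of_real s \<cdot>\<^sub>m X \<in> carrier_mat n n" using K X by simp
  show "mat_adjoint (K - complex_of_real s \<cdot>\<^sub>m X) = K - complex_of_real s \<cdot>\<^sub>m X"
    using K X by (simp add: mat_adjoint_minus[of _ n n] mat_adjoint_smult pos_semidef_matD(1))
  fix v :: "complex vec" assume v: "v \<in> carrier_vec n" "v \<noteq> 0\<^sub>v n"
  have "s * Re (conjugate v \<bullet> (X *\<^sub>v v)) \<le> Re (conjugate v \<bullet> (X *\<^sub>v v))"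
    using pos_semidef_matD(2)[OF X v(1)] s by (simp add: mult_left_le_one_le)
  moreover have "Re (conjugate v \<bullet> ((K - X) *\<^sub>v v)) > 0"
    using pos_def_matD(2)[OF KX _ v] K X by simp
  ultimately show "Re (conjugate v \<bullet> ((K - complex_of_real s \<cdot>\<^sub>m X) *\<^sub>v v)) > 0"
    using K X v by (simp add: sesq_minus[where n=n and m=n] sesq_smult[where n=n and m=n])
qed

lemma invertible_mat_if_adjoint_injective:
  assumes A: "(A :: complex mat) \<in> carrier_mat n n"
    and inj: "\<And>y. y \<in> carrier_vec n \<Longrightarrow> mat_adjoint A *\<^sub>v y = 0\<^sub>v n \<Longrightarrow> y = 0\<^sub>v n"
  shows "invertible_mat A"
proof -
  have A': "mat_adjoint A \<in> carrier_mat n n" using A by simp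
  have "det (mat_adjoint A) \<noteq> 0"
    using det_0_iff_vec_prod_zero[OF A'] inj by blast
  from det_non_zero_imp_unit[OF A' this, of "()"]
  obtain B where B: "B \<in> carrier_mat n n" "B * mat_adjoint A = 1\<^sub>m n" "mat_adjoint A * B = 1\<^sub>m n"
    unfolding Units_def ring_mat_def by auto
  have "A * mat_adjoint B = mat_adjoint (B * mat_adjoint A)" using mat_adjoint_mult[OF B(1) A'] by simp
  then have "A * mat_adjoint B = 1\<^sub>m n" using B(2) by simp
  moreover have "mat_adjoint B * A = 1\<^sub>m n" using mat_adjoint_mult[OF A' B(1)] B(3) by simp
  ultimately show ?thesis unfolding invertible_mat_def inverts_mat_def
    using A B(1) by (intro conjI exI[of _ "mat_adjoint B"]) auto
qed

lemma invertible_mat_minv: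
  assumes A: "(A :: complex mat) \<in> carrier_mat n n" and inv: "invertible_mat A"
  shows "minv A \<in> carrier_mat n n" "A * minv A = 1\<^sub>m n" "minv A * A = 1\<^sub>m n"
proof -
  from inv obtain B where B: "A * B = 1\<^sub>m (dim_row A)" "B * A = 1\<^sub>m (dim_row B)"
    unfolding invertible_mat_def inverts_mat_def by auto
  have "dim_row B = n" "dim_col B = n"
    using arg_cong[OF B(2), of dim_col] arg_cong[OF B(1), of dim_col] A by auto
  then have "\<exists>B. B \<in> carrier_mat (dim_row A) (dim_row A) \<and> A * B = 1\<^sub>m (dim_row A) \<and> B * A = 1\<^sub>m (dim_row A)"
    using B A by (intro exI[of _ B]) auto
  from someI_ex[OF this] show "minv A \<in> carrier_mat n n" "A * minv A = 1\<^sub>m n" "minv A * A = 1\<^sub>m n"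
    unfolding minv_def using A by auto
qed

section \<open>The Pick matrix and the Cayley transform\<close>

definition pick_mat :: "complex mat \<Rightarrow> complex mat \<Rightarrow> complex mat" where
  "pick_mat K X = X * K + K * mat_adjoint X"

lemma pick_mat_carrier_mat[simp]:
  "K \<in> carrier_mat n n \<Longrightarrow> X \<in> carrier_mat n n \<Longrightarrow> pick_mat K X \<in> carrier_mat n n"
  unfolding pick_mat_def by simp

lemma invertible_mat_if_pos_def_pick_minus:
  assumes M: "M \<in> carrier_mat n n" and K: "K \<in> carrier_mat n n" and R: "R \<in> carrier_mat n n"
    and pd: "pos_def_mat (pick_mat K M - R)"
    and R_nonneg: "\<And>y. y \<in> carrier_vec n \<Longrightarrow> mat_adjoint M *\<^sub>v y = 0\<^sub>v n \<Longrightarrow>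
      Re (conjugate y \<bullet> (R *\<^sub>v y)) \<ge> 0"
  shows "invertible_mat M"
proof (rule invertible_mat_if_adjoint_injective[OF M])
  fix y assume y: "y \<in> carrier_vec n" and ker: "mat_adjoint M *\<^sub>v y = 0\<^sub>v n"
  have "conjugate y \<bullet> ((M * K) *\<^sub>v y) = 0"
    using sesq_mult[OF M K y y] ker K y by simp
  moreover have "conjugate y \<bullet> ((K * mat_adjoint M) *\<^sub>v y) = 0"
    using sesq_mult[OF K mat_adjoint_carrier_mat[OF M] y y] ker K y by simp
  ultimately have "Re (conjugate y \<bullet> ((pick_mat K M - R) *\<^sub>v y)) \<le> 0"
    using R_nonneg[OF y ker] M K R y by (simp add: pick_mat_def sesq_add[where n=n and m=n]
      sesq_minus[where n=n and m=n])
  then show "y = 0\<^sub>v n" using pos_def_matD(2)[OF pd _ y] M K R by force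
qed

context
  fixes n :: nat
begin

(* With all dimensions fixed to n the simplifier can discharge the carrier premises. *)
lemmas square_mat_algebra =
  assoc_mult_mat[where n\<^sub>1=n and n\<^sub>2=n and n\<^sub>3=n and n\<^sub>4=n]
  add_mult_distrib_mat[where nr=n and n=n and nc=n]
  mult_add_distrib_mat[where nr=n and n=n and nc=n]
  minus_mult_distrib_mat[where nr=n and n=n and nc=n]
  mult_minus_distrib_mat[where nr=n and n=n and nc=n]
  right_mult_one_mat[where nr=n and nc=n] left_mult_one_mat[where nr=n and nc=n]
  mult_smult_distrib[where nr=n and n=n and nc=n] mult_smult_assoc_mat[where nr=n and n=n and nc=n]

lemma pick_mat_shift_half:
  assumes X: "X \<in> carrier_mat n n" and K: "K \<in> carrier_mat n n"
  shows "pick_mat K (X + (1/2) \<cdot>\<^sub>m 1\<^sub>m n) = pick_mat K X + K"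
    and "pick_mat K (X - (1/2) \<cdot>\<^sub>m 1\<^sub>m n) = pick_mat K X - K"
proof -
  have "mat_adjoint (X + (1/2) \<cdot>\<^sub>m 1\<^sub>m n) = mat_adjoint X + (1/2) \<cdot>\<^sub>m 1\<^sub>m n"
    using X by (simp add: mat_adjoint_add mat_adjoint_smult)
  then show "pick_mat K (X + (1/2) \<cdot>\<^sub>m 1\<^sub>m n) = pick_mat K X + K"
    unfolding pick_mat_def using X K by (simp add: square_mat_algebra) (rule eq_matI, auto)
  have "mat_adjoint (X - (1/2) \<cdot>\<^sub>m 1\<^sub>m n) = mat_adjoint X - (1/2) \<cdot>\<^sub>m 1\<^sub>m n"
    using X by (simp add: mat_adjoint_minus mat_adjoint_smult)
  then show "pick_mat K (X - (1/2) \<cdot>\<^sub>m 1\<^sub>m n) = pick_mat K X - K"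
    unfolding pick_mat_def using X K by (simp add: square_mat_algebra) (rule eq_matI, auto)
qed

lemma pick_mat_congruence:
  assumes X: "X \<in> carrier_mat n n" and Y: "Y \<in> carrier_mat n n" and K: "K \<in> carrier_mat n n"
    and YX: "Y * X = 1\<^sub>m n"
  shows "Y * (pick_mat K X - K) * mat_adjoint Y = pick_mat K Y - Y * K * mat_adjoint Y"
proof -
  have XY': "mat_adjoint X * mat_adjoint Y = 1\<^sub>m n" using mat_adjoint_mult[OF Y X] YX by simp
  have "Y * (X * K) = K" using X Y K YX by (simp flip: square_mat_algebra(1))
  then have "Y * (pick_mat K X - K) = K + Y * K * mat_adjoint X - Y * K"
    unfolding pick_mat_def using X Y K by (simp add: square_mat_algebra)
  moreover have "Y * K * mat_adjoint X * mat_adjoint Y = Y * K"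
    using X Y K XY' by (simp add: square_mat_algebra)
  ultimately show ?thesis unfolding pick_mat_def
    using X Y K by (simp add: square_mat_algebra comm_add_mat[of "K * mat_adjoint Y" n n])
qed

lemma pick_mat_one_minus_smult:
  fixes s :: complex
  assumes T: "T \<in> carrier_mat n n" and K: "K \<in> carrier_mat n n"
  defines "M \<equiv> 1\<^sub>m n - s \<cdot>\<^sub>m T"
  shows "pick_mat K M - M * K * mat_adjoint M = K - (s * cnj s) \<cdot>\<^sub>m (T * K * mat_adjoint T)"
proof -
  have "mat_adjoint M = 1\<^sub>m n - cnj s \<cdot>\<^sub>m mat_adjoint T"
    unfolding M_def using T by (intro eq_matI) auto
  then show ?thesis unfolding pick_mat_def M_def
    using T K by (simp add: square_mat_algebra) (rule eq_matI, auto simp: algebra_simps)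
qed

lemma congruence_cancel:
  fixes X Y G :: "complex mat"
  assumes X: "X \<in> carrier_mat n n" and Y: "Y \<in> carrier_mat n n" and G: "G \<in> carrier_mat n n"
    and YX: "Y * X = 1\<^sub>m n"
  shows "Y * (X * G * mat_adjoint X) * mat_adjoint Y = G"
proof -
  have XY': "mat_adjoint X * mat_adjoint Y = 1\<^sub>m n" using mat_adjoint_mult[OF Y X] YX by simp
  have "Y * (X * G * mat_adjoint X) * mat_adjoint Y = (Y * X) * G * (mat_adjoint X * mat_adjoint Y)"
    using X Y G by (simp add: square_mat_algebra)
  also have "\<dots> = G" using YX XY' G by simp
  finally show ?thesis .
qed

end

lemma cayley_transform_stein_pos_def:
  assumes W: "W \<in> carrier_mat n n" and K: "K \<in> carrier_mat n n" and psdK: "pos_semidef_mat K"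
    and pick: "pos_def_mat (pick_mat K W)"
  defines "T \<equiv> (W - (1/2) \<cdot>\<^sub>m 1\<^sub>m n) * minv (W + (1/2) \<cdot>\<^sub>m 1\<^sub>m n)"
  shows "invertible_mat (W + (1/2) \<cdot>\<^sub>m 1\<^sub>m n)" and "T \<in> carrier_mat n n"
    and "pos_def_mat (K - T * K * mat_adjoint T)"
proof -
  define A where "A = W + (1/2) \<cdot>\<^sub>m 1\<^sub>m n"
  have A: "A \<in> carrier_mat n n" unfolding A_def using W by simp
  have pickA: "pick_mat K A - K = pick_mat K W"
    unfolding A_def pick_mat_shift_half(1)[OF W K]
    using carrier_matD[OF pick_mat_carrier_mat[OF K W]] K by (intro eq_matI) auto
  have "invertible_mat A"
    using pick psdK K pos_semidef_matD(2)[OF psdK K]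
    by (intro invertible_mat_if_pos_def_pick_minus[OF A K K]) (simp_all add: pickA)
  then show "invertible_mat (W + (1/2) \<cdot>\<^sub>m 1\<^sub>m n)" unfolding A_def .
  define B where "B = minv A"
  note B = invertible_mat_minv[OF A \<open>invertible_mat A\<close>, folded B_def]
  have "W - (1/2) \<cdot>\<^sub>m 1\<^sub>m n = A - 1\<^sub>m n" unfolding A_def using W by (intro eq_matI) auto
  then have TB: "T = 1\<^sub>m n - B"
    unfolding T_def A_def[symmetric] B_def[symmetric] using A B by (simp add: square_mat_algebra)
  then show T: "T \<in> carrier_mat n n" using B by simp
  have "B = 1\<^sub>m n - 1 \<cdot>\<^sub>m T" using TB B by (intro eq_matI) auto
  moreover have "1 \<cdot>\<^sub>m (T * K * mat_adjoint T) = T * K * mat_adjoint T"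
    using T K by (intro eq_matI) auto
  ultimately have "B * (pick_mat K A - K) * mat_adjoint B = K - T * K * mat_adjoint T"
    using pick_mat_congruence[OF A B(1) K B(3)] pick_mat_one_minus_smult[OF T K, of 1] by simp
  moreover have "pos_def_mat (B * (pick_mat K A - K) * mat_adjoint B)"
    using pos_def_mat_congruence[OF pick _ B(1) A B(3)] W K by (simp add: pickA)
  ultimately show "pos_def_mat (K - T * K * mat_adjoint T)" by simp
qed

lemma resolvent_pick_pos_def:
  assumes T: "T \<in> carrier_mat n n" and K: "K \<in> carrier_mat n n" and psdK: "pos_semidef_mat K"
    and stein: "pos_def_mat (K - T * K * mat_adjoint T)" and t: "0 \<le> t" "t \<le> 1"
  defines "M \<equiv> 1\<^sub>m n - complex_of_real t \<cdot>\<^sub>m T"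
  shows "invertible_mat M" and "pos_def_mat (pick_mat K (minv M - (1/2) \<cdot>\<^sub>m 1\<^sub>m n))"
proof -
  have M: "M \<in> carrier_mat n n" unfolding M_def using T by simp
  define Q where "Q = pick_mat K M - M * K * mat_adjoint M"
  have Q: "Q \<in> carrier_mat n n" unfolding Q_def using M K by simp
  have "Q = K - complex_of_real (t * t) \<cdot>\<^sub>m (T * K * mat_adjoint T)"
    unfolding Q_def M_def using pick_mat_one_minus_smult[OF T K, of "complex_of_real t"] by simp
  moreover have "pos_def_mat (K - complex_of_real (t * t) \<cdot>\<^sub>m (T * K * mat_adjoint T))"
    using pos_def_mat_minus_smult[OF psdK K pos_semidef_mat_congruence[OF psdK K T] _ stein] T K t
    by (simp add: mult_le_one del: of_real_mult)
  ultimately have pdQ: "pos_def_mat Q" by simp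
  have "Re (conjugate y \<bullet> ((M * K * mat_adjoint M) *\<^sub>v y)) \<ge> 0"
    if "y \<in> carrier_vec n" "mat_adjoint M *\<^sub>v y = 0\<^sub>v n" for y
    using sesq_congruence[OF M K that(1) that(1)] that K by simp
  then show invM: "invertible_mat M"
    using invertible_mat_if_pos_def_pick_minus[OF M K _ pdQ[unfolded Q_def]] M K by simp
  define C where "C = minv M"
  note C = invertible_mat_minv[OF M invM, folded C_def]
  define G where "G = pick_mat K C - K"
  have G: "G \<in> carrier_mat n n" unfolding G_def using C K by simp
  have "M * G * mat_adjoint M = Q"
    unfolding G_def Q_def using pick_mat_congruence[OF C(1) M K C(2)] .
  then have "C * Q * mat_adjoint C = G"
    using congruence_cancel[OF M C(1) G C(3)] by simp
  then have "pos_def_mat G" using pos_def_mat_congruence[OF pdQ Q C(1) M C(3)] by simp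
  then show "pos_def_mat (pick_mat K (minv M - (1/2) \<cdot>\<^sub>m 1\<^sub>m n))"
    unfolding G_def C_def pick_mat_shift_half(2)[OF C(1)[unfolded C_def] K] .
qed

section \<open>The Stein equation\<close>

lemma linear_recurrence_tendsto_zero:
  fixes a e :: "nat \<Rightarrow> complex" and c :: complex
  assumes rec: "\<And>k. a (Suc k) = c * a k + e k" and c: "cmod c < 1" and e: "e \<longlonglongrightarrow> 0"
  shows "a \<longlonglongrightarrow> 0"
proof (rule LIMSEQ_I)
  fix eps :: real assume "0 < eps"
  define r where "r = cmod c"
  define d where "d = eps / 2"
  have r: "0 \<le> r" "r < 1" using c unfolding r_def by auto
  have d: "0 < d" using \<open>0 < eps\<close> unfolding d_def by auto
  obtain K where K: "\<And>k. k \<ge> K \<Longrightarrow> cmod (e k) < d * (1 - r)"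
    using LIMSEQ_D[OF e, of "d * (1 - r)"] d r by auto
  \<comment> \<open>Beyond K the excess of cmod a over d contracts by the factor r.\<close>
  define excess where "excess k = max (cmod (a k) - d) 0" for k
  have contract: "excess (Suc k) \<le> r * excess k" if "k \<ge> K" for k
  proof -
    have "cmod (a (Suc k)) \<le> r * cmod (a k) + cmod (e k)"
      unfolding rec r_def using norm_triangle_ineq[of "c * a k" "e k"] by (simp add: norm_mult)
    then have "cmod (a (Suc k)) - d \<le> r * (cmod (a k) - d)"
      using K[OF that] by (simp add: algebra_simps)
    also have "\<dots> \<le> r * excess k" unfolding excess_def using r by (intro mult_left_mono) auto
    finally show ?thesis unfolding excess_def using r by auto
  qed
  have geometric: "excess (K + j) \<le> r ^ j * excess K" for j
  proof (induction j)
    case (Suc j)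
    have "excess (K + Suc j) \<le> r * excess (K + j)" using contract[of "K + j"] by simp
    also have "\<dots> \<le> r * (r ^ j * excess K)" using Suc r by (intro mult_left_mono) auto
    finally show ?case by (simp add: mult.assoc)
  qed simp
  have "(\<lambda>j. r ^ j * excess K) \<longlonglongrightarrow> 0"
    by (intro tendsto_mult_left_zero LIMSEQ_power_zero) (use r in auto)
  then obtain J where J: "\<And>j. j \<ge> J \<Longrightarrow> r ^ j * excess K < d"
    using LIMSEQ_D[OF _ d] by fastforce
  have "cmod (a k) < eps" if "k \<ge> K + J" for k
  proof -
    have "J \<le> k - K" "K + (k - K) = k" using that by simp_all
    then have "excess k < d" using geometric[of "k - K"] J[of "k - K"] by (metis order_le_less_trans)
    then show ?thesis unfolding excess_def d_def by (simp add: max_def split: if_split_asm)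
  qed
  then show "\<exists>k0. \<forall>k\<ge>k0. norm (a k - 0) < eps" by auto
qed

lemma upper_triangular_mult_mat_vec_index:
  assumes U: "U \<in> carrier_mat n n" and upper: "upper_triangular U"
    and v: "v \<in> carrier_vec n" and i: "i < n"
  shows "(U *\<^sub>v v) $ i = U $$ (i, i) * v $ i + (\<Sum>j\<in>{Suc i..<n}. U $$ (i, j) * v $ j)"
proof -
  have "(U *\<^sub>v v) $ i = (\<Sum>j\<in>{0..<n}. U $$ (i, j) * v $ j)"
    using U v i by (auto simp: scalar_prod_def intro!: sum.cong)
  also have "\<dots> = (\<Sum>j\<in>{0..<Suc i}. U $$ (i, j) * v $ j) + (\<Sum>j\<in>{Suc i..<n}. U $$ (i, j) * v $ j)"
    using i by (intro sum.atLeastLessThan_concat[symmetric]) auto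
  also have "(\<Sum>j\<in>{0..<Suc i}. U $$ (i, j) * v $ j) = U $$ (i, i) * v $ i"
    using upper_triangularD[OF upper _ i[folded carrier_matD(1)[OF U]]] by simp
  finally show ?thesis .
qed

text \<open>Coordinate i of the iterates obeys a damped linear recurrence driven by the coordinates
  of larger index, so downward induction on i applies.\<close>

lemma upper_triangular_funpow_tendsto_zero:
  assumes U: "U \<in> carrier_mat n n" and upper: "upper_triangular U"
    and diag: "\<And>i. i < n \<Longrightarrow> cmod (U $$ (i, i)) < 1" and x: "x \<in> carrier_vec n"
  shows "i < n \<Longrightarrow> (\<lambda>k. ((*\<^sub>v) U ^^ k) x $ i) \<longlonglongrightarrow> 0"
proof (induction "n - i" arbitrary: i rule: less_induct)
  case less
  define y where "y k = ((*\<^sub>v) U ^^ k) x" for k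
  have y: "y k \<in> carrier_vec n" for k
    unfolding y_def by (induction k) (use U x in auto)
  have rec: "y (Suc k) $ i = U $$ (i, i) * y k $ i + (\<Sum>j\<in>{Suc i..<n}. U $$ (i, j) * y k $ j)" for k
    using upper_triangular_mult_mat_vec_index[OF U upper y less.prems] by (simp add: y_def)
  have "(\<lambda>k. \<Sum>j\<in>{Suc i..<n}. U $$ (i, j) * y k $ j) \<longlonglongrightarrow> 0"
  proof (intro tendsto_null_sum tendsto_mult_right_zero)
    fix j assume "j \<in> {Suc i..<n}"
    then show "(\<lambda>k. y k $ j) \<longlonglongrightarrow> 0" unfolding y_def by (intro less) auto
  qed
  then have "(\<lambda>k. y k $ i) \<longlonglongrightarrow> 0"
    by (rule linear_recurrence_tendsto_zero[where a = "\<lambda>k. y k $ i", OF rec diag[OF less.prems]])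
  then show ?case unfolding y_def .
qed

definition schur_stable_lower_triangular :: "complex mat \<Rightarrow> bool" where
  "schur_stable_lower_triangular A \<longleftrightarrow> square_mat A \<and>
     (\<forall>i < dim_row A. \<forall>j < dim_row A. i < j \<longrightarrow> A $$ (i, j) = 0) \<and>
     (\<forall>i < dim_row A. cmod (A $$ (i, i)) < 1)"

lemma stein_sesq_step:
  fixes Z S E :: "complex mat"
  assumes Z: "Z \<in> carrier_mat n n" and S: "S \<in> carrier_mat n n" and E: "E \<in> carrier_mat n n"
    and stein: "S = Z * S * mat_adjoint Z + E"
    and v: "v \<in> carrier_vec n" and w: "w \<in> carrier_vec n"
  shows "conjugate v \<bullet> (S *\<^sub>v w)
    = conjugate (mat_adjoint Z *\<^sub>v v) \<bullet> (S *\<^sub>v (mat_adjoint Z *\<^sub>v w)) + conjugate v \<bullet> (E *\<^sub>v w)"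
proof -
  have "conjugate v \<bullet> (S *\<^sub>v w) = conjugate v \<bullet> ((Z * S * mat_adjoint Z + E) *\<^sub>v w)"
    using arg_cong[OF stein, of "\<lambda>A. conjugate v \<bullet> (A *\<^sub>v w)"] .
  also have "\<dots> = conjugate v \<bullet> ((Z * S * mat_adjoint Z) *\<^sub>v w) + conjugate v \<bullet> (E *\<^sub>v w)"
    using sesq_add[of "Z * S * mat_adjoint Z" n n E v w] Z S E v w by simp
  finally show ?thesis unfolding sesq_congruence[OF Z S v w] .
qed

text \<open>The remainder of the iterated Stein equation vanishes because the adjoint of Z is
  upper triangular with its diagonal in the unit disc.\<close>

lemma stein_form_sums:
  fixes Z S E :: "complex mat"
  assumes Z: "Z \<in> carrier_mat n n" and stable: "schur_stable_lower_triangular Z"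
    and S: "S \<in> carrier_mat n n" and E: "E \<in> carrier_mat n n"
    and stein: "S = Z * S * mat_adjoint Z + E"
    and x: "x \<in> carrier_vec n" and y: "y \<in> carrier_vec n"
  shows "(\<lambda>k. conjugate (((*\<^sub>v) (mat_adjoint Z) ^^ k) x) \<bullet> (E *\<^sub>v ((*\<^sub>v) (mat_adjoint Z) ^^ k) y))
    sums (conjugate x \<bullet> (S *\<^sub>v y))"
proof -
  define U where "U = mat_adjoint Z"
  define p where "p k v = ((*\<^sub>v) U ^^ k) v" for k v
  have U: "U \<in> carrier_mat n n" unfolding U_def using Z by simp
  have p: "p k v \<in> carrier_vec n" if "v \<in> carrier_vec n" for k v
    unfolding p_def by (induction k) (use U that in auto)
  have partial_sums: "conjugate x \<bullet> (S *\<^sub>v y)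
    = conjugate (p k x) \<bullet> (S *\<^sub>v p k y) + (\<Sum>j<k. conjugate (p j x) \<bullet> (E *\<^sub>v p j y))" for k
  proof (induction k)
    case (Suc k)
    have "p (Suc k) v = U *\<^sub>v p k v" for v unfolding p_def by simp
    then show ?case
      unfolding Suc.IH stein_sesq_step[OF Z S E stein p[OF x] p[OF y], of k k, folded U_def]
      by (simp add: algebra_simps)
  qed (simp add: p_def)
  have upper: "upper_triangular U"
    using stable Z unfolding U_def schur_stable_lower_triangular_def by (intro upper_triangularI) auto
  have diag: "cmod (U $$ (i, i)) < 1" if "i < n" for i
    using stable Z that unfolding U_def schur_stable_lower_triangular_def by auto
  have decay: "(\<lambda>k. p k v $ i) \<longlonglongrightarrow> 0" if "v \<in> carrier_vec n" "i < n" for v i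
    unfolding p_def using upper_triangular_funpow_tendsto_zero[OF U upper diag that] .
  have "(\<lambda>k. conjugate (p k x) \<bullet> (S *\<^sub>v p k y)) \<longlonglongrightarrow> 0"
    by (intro sesq_tendsto_zero[OF S p[OF x] p[OF y]] decay x y)
  then have "(\<lambda>k. conjugate x \<bullet> (S *\<^sub>v y) - conjugate (p k x) \<bullet> (S *\<^sub>v p k y))
    \<longlonglongrightarrow> conjugate x \<bullet> (S *\<^sub>v y) - 0"
    by (intro tendsto_diff tendsto_const)
  moreover have "(\<Sum>j<k. conjugate (p j x) \<bullet> (E *\<^sub>v p j y))
    = conjugate x \<bullet> (S *\<^sub>v y) - conjugate (p k x) \<bullet> (S *\<^sub>v p k y)" for k
    using partial_sums[of k] by (simp add: algebra_simps)
  ultimately show ?thesis unfolding sums_def p_def U_def by simp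
qed

lemma stein_solution_pos_semidef:
  assumes Z: "Z \<in> carrier_mat n n" and stable: "schur_stable_lower_triangular Z"
    and S: "S \<in> carrier_mat n n" and E: "pos_semidef_mat E" "E \<in> carrier_mat n n"
    and stein: "S = Z * S * mat_adjoint Z + E"
  shows "pos_semidef_mat S"
proof (rule pos_semidef_matI[OF S])
  note sums = stein_form_sums[OF Z stable S E(2) stein]
  define p where "p k v = ((*\<^sub>v) (mat_adjoint Z) ^^ k) v" for k v
  have p: "p k v \<in> carrier_vec n" if "v \<in> carrier_vec n" for k v
    unfolding p_def by (induction k) (use Z that in auto)
  show "mat_adjoint S = S"
  proof (rule eq_matI)
    fix i j assume "i < dim_row S" "j < dim_col S"
    then have ij: "i < n" "j < n" using S by auto
    have herm_terms: "conjugate (p k (unit_vec n i)) \<bullet> (E *\<^sub>v p k (unit_vec n j))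
      = cnj (conjugate (p k (unit_vec n j)) \<bullet> (E *\<^sub>v p k (unit_vec n i)))" for k
      by (rule sesq_hermitian[OF E(2) pos_semidef_matD(1)[OF E] p p]) simp_all
    have "(\<lambda>k. conjugate (p k (unit_vec n i)) \<bullet> (E *\<^sub>v p k (unit_vec n j))) sums S $$ (i, j)"
      using sums[OF unit_vec_carrier unit_vec_carrier, of i j] sesq_unit_vec[OF S ij] by (simp add: p_def)
    moreover have "(\<lambda>k. conjugate (p k (unit_vec n j)) \<bullet> (E *\<^sub>v p k (unit_vec n i))) sums S $$ (j, i)"
      using sums[OF unit_vec_carrier unit_vec_carrier, of j i] sesq_unit_vec[OF S ij(2,1)]
      by (simp add: p_def)
    then have "(\<lambda>k. conjugate (p k (unit_vec n i)) \<bullet> (E *\<^sub>v p k (unit_vec n j)))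
      sums cnj (S $$ (j, i))"
      unfolding herm_terms by (rule sums_cnj[THEN iffD2])
    ultimately have "S $$ (i, j) = cnj (S $$ (j, i))" by (rule sums_unique2)
    then show "mat_adjoint S $$ (i, j) = S $$ (i, j)" using S ij by simp
  qed (use S in auto)
  show "Re (conjugate v \<bullet> (S *\<^sub>v v)) \<ge> 0" if v: "v \<in> carrier_vec n" for v
  proof -
    have Re_sums: "(\<lambda>k. Re (conjugate (p k v) \<bullet> (E *\<^sub>v p k v))) sums Re (conjugate v \<bullet> (S *\<^sub>v v))"
      using sums_Re[OF sums[OF v v]] unfolding p_def .
    show ?thesis by (rule sums_le[OF _ sums_zero Re_sums]) (rule pos_semidef_matD(2)[OF E p[OF v]])
  qed
qed

section \<open>The interpolation data\<close>

lemma schur_stable_lower_triangular_diag_block_mat: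
  "(\<And>A. A \<in> set As \<Longrightarrow> schur_stable_lower_triangular A) \<Longrightarrow>
    schur_stable_lower_triangular (diag_block_mat As)"
proof (induction As)
  case (Cons A As)
  then have "schur_stable_lower_triangular A" "schur_stable_lower_triangular (diag_block_mat As)"
    by auto
  then show ?case unfolding diag_block_mat.simps Let_def schur_stable_lower_triangular_def by auto
qed (simp add: schur_stable_lower_triangular_def)

lemma Z_big_schur_stable:
  assumes z: "\<And>j. j \<le> m \<Longrightarrow> cmod (z j) < 1"
  shows "Z_big m ns z \<in> carrier_mat (total_size m ns) (total_size m ns)"
    and "schur_stable_lower_triangular (Z_big m ns z)"
proof -
  show stable: "schur_stable_lower_triangular (Z_big m ns z)" unfolding Z_big_def
  proof (rule schur_stable_lower_triangular_diag_block_mat)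
    fix A assume "A \<in> set (map (\<lambda>j. Z_block (ns j) (z j)) [0..<Suc m])"
    then obtain j where "j < Suc m" "A = Z_block (ns j) (z j)" by (auto simp del: upt_Suc)
    then show "schur_stable_lower_triangular A"
      unfolding schur_stable_lower_triangular_def Z_block_def using z[of j] by auto
  qed
  have "dim_row (Z_big m ns z) = total_size m ns"
    unfolding Z_big_def dim_diag_block_mat total_size_def
    by (simp add: Z_block_def sum_list_distinct_conv_sum_set atLeast0_lessThan_Suc
        lessThan_Suc_atMost[symmetric] atLeast0LessThan)
  then show "Z_big m ns z \<in> carrier_mat (total_size m ns) (total_size m ns)"
    using stable unfolding schur_stable_lower_triangular_def by (intro carrier_matI) auto
qed

lemma W_big_carrier_mat:
  "W_big l m ns Wb \<in> carrier_mat (l * total_size m ns) (l * total_size m ns)"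
  unfolding W_big_def total_size_def
  by (intro carrier_matI, unfold dim_diag_block_mat)
    (simp_all add: toeplitz_block_def sum_list_distinct_conv_sum_set atLeast0_lessThan_Suc
      lessThan_Suc_atMost[symmetric] atLeast0LessThan sum_distrib_left distrib_left)

lemma outer_e_carrier_mat: "outer_e m ns \<in> carrier_mat (total_size m ns) (total_size m ns)"
  unfolding outer_e_def by simp

lemma pos_semidef_outer_e: "pos_semidef_mat (outer_e m ns)"
proof (rule pos_semidef_matI[OF outer_e_carrier_mat])
  let ?n = "total_size m ns" and ?e = "e_vec m ns"
  have e_real: "cnj (?e $ i) = ?e $ i" if "i < ?n" for i
    using that unfolding e_vec_def by auto
  show "mat_adjoint (outer_e m ns) = outer_e m ns"
    unfolding outer_e_def by (rule eq_matI) (auto simp: e_real mult.commute)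
  fix x :: "complex vec" assume x: "x \<in> carrier_vec ?n"
  define s where "s = (\<Sum>k<?n. ?e $ k * x $ k)"
  have "conjugate x \<bullet> (outer_e m ns *\<^sub>v x) = (\<Sum>i<?n. \<Sum>k<?n. cnj (x $ i) * (?e $ i * ?e $ k) * x $ k)"
    unfolding sesq_sum[OF outer_e_carrier_mat x x] unfolding outer_e_def by (intro sum.cong refl) auto
  also have "\<dots> = (\<Sum>i<?n. \<Sum>k<?n. cnj (?e $ i * x $ i) * (?e $ k * x $ k))"
    by (intro sum.cong refl) (auto simp: e_real mult_ac)
  also have "\<dots> = cnj s * s"
    unfolding s_def cnj_sum sum_product ..
  finally show "Re (conjugate x \<bullet> (outer_e m ns *\<^sub>v x)) \<ge> 0" by simp
qed

lemma sum_lessThan_mult_split: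
  fixes F :: "nat \<Rightarrow> 'a :: comm_monoid_add"
  shows "(\<Sum>r < l * n. F r) = (\<Sum>i<n. \<Sum>q<l. F (i * l + q))"
proof -
  have "(\<Sum>r < l * n. F r) = (\<Sum>i<n. sum F {i * l..<i * l + l})"
    using sum.nat_group[where g=F and k=l and n=n] by (simp add: mult.commute)
  also have "\<dots> = (\<Sum>i<n. \<Sum>q<l. F (i * l + q))"
  proof (rule sum.cong[OF refl])
    fix i
    have "sum F {0 + i * l..<l + i * l} = (\<Sum>q\<in>{0..<l}. F (q + i * l))"
      by (rule sum.shift_bounds_nat_ivl)
    then show "sum F {i * l..<i * l + l} = (\<Sum>q<l. F (i * l + q))"
      by (simp add: add.commute atLeast0LessThan)
  qed
  finally show ?thesis .
qed

lemma kron_id_carrier_mat: "S \<in> carrier_mat n n \<Longrightarrow> kron_id S l \<in> carrier_mat (l * n) (l * n)"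
  unfolding kron_id_def by (auto simp: mult.commute)

lemma index_kron_id_block:
  assumes "S \<in> carrier_mat n n" "i < n" "j < n" "q < l" "p < l"
  shows "kron_id S l $$ (i * l + q, j * l + p) = (if q = p then S $$ (i, j) else 0)"
proof -
  have bound: "a * l + b < n * l" if "a < n" "b < l" for a b
  proof -
    have "a * l + b < (a + 1) * l" using that by simp
    also have "\<dots> \<le> n * l" using that by (intro mult_right_mono) auto
    finally show ?thesis .
  qed
  have "i * l + q < n * l" "j * l + p < n * l" using assms by (simp_all add: bound)
  then show ?thesis using assms unfolding kron_id_def by auto
qed

lemma mat_adjoint_kron_id:
  assumes "S \<in> carrier_mat n n"
  shows "mat_adjoint (kron_id S l) = kron_id (mat_adjoint S) l"
  using assms by (intro eq_matI) (auto simp: kron_id_def less_mult_imp_div_less)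

lemma pos_semidef_mat_kron_id:
  assumes S: "pos_semidef_mat S" "S \<in> carrier_mat n n"
  shows "pos_semidef_mat (kron_id S l)"
proof (rule pos_semidef_matI[OF kron_id_carrier_mat[OF S(2)]])
  let ?K = "kron_id S l"
  show "mat_adjoint ?K = ?K"
    using mat_adjoint_kron_id[OF S(2)] pos_semidef_matD(1)[OF S] by simp
  fix x :: "complex vec" assume x: "x \<in> carrier_vec (l * n)"
  \<comment> \<open>The form of S \<otimes> I splits into the forms of S on the l interleaved subvectors of x.\<close>
  define xq where "xq q = vec n (\<lambda>i. x $ (i * l + q))" for q
  have xq: "xq q \<in> carrier_vec n" for q unfolding xq_def by simp
  have "conjugate x \<bullet> (?K *\<^sub>v x)
      = (\<Sum>i<n. \<Sum>q<l. \<Sum>j<n. \<Sum>p<l. cnj (x $ (i*l+q)) * ?K $$ (i*l+q, j*l+p) * x $ (j*l+p))"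
    by (simp add: sesq_sum[OF kron_id_carrier_mat[OF S(2)] x x] sum_lessThan_mult_split)
  also have "\<dots> = (\<Sum>i<n. \<Sum>q<l. \<Sum>j<n. cnj (x $ (i*l+q)) * S $$ (i, j) * x $ (j*l+q))"
  proof (intro sum.cong refl)
    fix i q j assume ijq: "i \<in> {..<n}" "q \<in> {..<l}" "j \<in> {..<n}"
    have "(\<Sum>p<l. cnj (x $ (i*l+q)) * ?K $$ (i*l+q, j*l+p) * x $ (j*l+p))
        = (\<Sum>p<l. if p = q then cnj (x $ (i*l+q)) * S $$ (i, j) * x $ (j*l+q) else 0)"
      using ijq by (intro sum.cong refl) (auto simp: index_kron_id_block[OF S(2)])
    then show "(\<Sum>p<l. cnj (x $ (i*l+q)) * ?K $$ (i*l+q, j*l+p) * x $ (j*l+p))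
        = cnj (x $ (i*l+q)) * S $$ (i, j) * x $ (j*l+q)"
      using ijq by simp
  qed
  also have "\<dots> = (\<Sum>q<l. conjugate (xq q) \<bullet> (S *\<^sub>v xq q))"
    by (subst sum.swap, intro sum.cong refl, subst sesq_sum[OF S(2) xq xq]) (simp add: xq_def)
  finally have "Re (conjugate x \<bullet> (?K *\<^sub>v x)) = (\<Sum>q<l. Re (conjugate (xq q) \<bullet> (S *\<^sub>v xq q)))"
    by simp
  also have "\<dots> \<ge> 0" using pos_semidef_matD(2)[OF S xq] by (intro sum_nonneg) auto
  finally show "Re (conjugate x \<bullet> (?K *\<^sub>v x)) \<ge> 0" .
qed

theorem lemma4:
  fixes l m :: nat
    and ns :: "nat \<Rightarrow> nat"
    and z :: "nat \<Rightarrow> complex"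
    and Wb :: "nat \<Rightarrow> nat \<Rightarrow> complex mat"
    and S :: "complex mat"
  assumes l_pos: "l \<ge> 1"
    and ns_pos: "\<And>j. j \<le> m \<Longrightarrow> ns j \<ge> 1"
    and z0: "z 0 = 0"
    and z_disc: "\<And>j. j \<le> m \<Longrightarrow> cmod (z j) < 1"
    and z_distinct: "inj_on z {0..m}"
    and Wb_dim: "\<And>j k. j \<le> m \<Longrightarrow> k < ns j \<Longrightarrow> Wb j k \<in> carrier_mat l l"
    and S_dim: "S \<in> carrier_mat (total_size m ns) (total_size m ns)"
    and S_lyap: "S = Z_big m ns z * S * mat_adjoint (Z_big m ns z) + outer_e m ns"
    and pick: "pos_def_mat (W_big l m ns Wb * kron_id S l + kron_id S l * mat_adjoint (W_big l m ns Wb))"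
  shows "let W = W_big l m ns Wb; N = l * total_size m ns;
             Ih = (1/2) \<cdot>\<^sub>m 1\<^sub>m N;
             T = (W - Ih) * minv (W + Ih)
         in invertible_mat (W + Ih) \<and>
            (\<forall>t::real. 0 \<le> t \<and> t \<le> 1 \<longrightarrow>
               (let IlT = 1\<^sub>m N - complex_of_real t \<cdot>\<^sub>m T;
                    Wt = minv IlT - Ih
                in invertible_mat IlT \<and>
                   pos_def_mat (Wt * kron_id S l + kron_id S l * mat_adjoint Wt)))"
proof -
  let ?K = "kron_id S l"
  have "pos_semidef_mat S"
    using stein_solution_pos_semidef[OF Z_big_schur_stable[OF z_disc] S_dim
        pos_semidef_outer_e outer_e_carrier_mat S_lyap] .
  then have K: "?K \<in> carrier_mat (l * total_size m ns) (l * total_size m ns)" "pos_semidef_mat ?K"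
    using kron_id_carrier_mat[OF S_dim] pos_semidef_mat_kron_id[OF _ S_dim] by auto
  note cayley = cayley_transform_stein_pos_def[OF W_big_carrier_mat K pick[folded pick_mat_def]]
  show ?thesis
    unfolding Let_def pick_mat_def[symmetric]
    using cayley(1) resolvent_pick_pos_def[OF cayley(2) K cayley(3)] by simp
qed

end
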